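(* Let $\mathcal{T}_0=(A_0,B_0,C_0)$ be a triangle with pairwise distinct vertices on the circle $\mathcal{S}$ of center $O$ and radius $1$ in the Euclidean plane, and let $(\mathcal{T}_n)_{n\ge0}$ be the sequence of triangles produced from it by the iteration described in the context. Then the sequences of triangles $(\mathcal{T}_{2i})_{i\in\mathbb{N}}$ and $(\mathcal{T}_{2i+1})_{i\in\mathbb{N}}$ are well defined and converge with at least quadratic speed to two equilateral triangles that are symmetric to each other with respect to $O$ (corresponding vertices are antipodal).
   Context: Iteration: given $\mathcal{T}_n=(A_n,B_n,C_n)\in\mathcal{S}^3$ with centroid $G_n$, $\mathcal{T}_{n+1}=(A_{n+1},B_{n+1},C_{n+1})$, where $A_{n+1}$ is the second intersection point of the line $G_nA_n$ with $\mathcal{S}$ (other than $A_n$), and similarly for $B_{n+1},C_{n+1}$. "Converge with at least quadratic speed" means: there is $\lambda\in(0,1)$ such that the distance between each vertex of $\mathcal{T}_n$ and the corresponding vertex of the limit of the subsequence ($n$ even, respectively $n$ odd) is $O(\lambda^{2^n})$. *)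

theory Defs
  imports "HOL-Analysis.Analysis" "HOL-Library.Landau_Symbols"
begin

text \<open>
  The Euclidean plane is the type \<open>complex\<close>; a triangle is the ordered triple of its vertices;
  \<open>c\<close> is the centre of the circle \<open>sphere c 1\<close>.
\<close>

type_synonym triangle = "complex \<times> complex \<times> complex"

fun inscribed_triangle :: "complex \<Rightarrow> triangle \<Rightarrow> bool" where
  "inscribed_triangle c (A, B, C) \<longleftrightarrow>
     A \<in> sphere c 1 \<and> B \<in> sphere c 1 \<and> C \<in> sphere c 1 \<and> A \<noteq> B \<and> B \<noteq> C \<and> C \<noteq> A"

fun centroid :: "triangle \<Rightarrow> complex" where
  "centroid (A, B, C) = (A + B + C) / 3"

definition is_second_intersection :: "complex \<Rightarrow> complex \<Rightarrow> complex \<Rightarrow> complex \<Rightarrow> bool" where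
  "is_second_intersection c G A P \<longleftrightarrow> P \<in> affine hull {G, A} \<and> P \<in> sphere c 1 \<and> P \<noteq> A"

definition second_intersection :: "complex \<Rightarrow> complex \<Rightarrow> complex \<Rightarrow> complex" where
  "second_intersection c G A = (THE P. is_second_intersection c G A P)"

text \<open>
  The function \<open>second_intersection\<close> is meaningful only if \<open>G \<noteq> A\<close>, so that the line \<open>GA\<close>
  exists, and this line meets the circle in exactly one point other than \<open>A\<close>.
\<close>

definition second_intersection_defined :: "complex \<Rightarrow> complex \<Rightarrow> complex \<Rightarrow> bool" where
  "second_intersection_defined c G A \<longleftrightarrow> G \<noteq> A \<and> (\<exists>!P. is_second_intersection c G A P)"

fun next_triangle :: "complex \<Rightarrow> triangle \<Rightarrow> triangle" where
  "next_triangle c (A, B, C) =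
     (let G = centroid (A, B, C)
      in (second_intersection c G A, second_intersection c G B, second_intersection c G C))"

fun next_triangle_defined :: "complex \<Rightarrow> triangle \<Rightarrow> bool" where
  "next_triangle_defined c (A, B, C) \<longleftrightarrow>
     (let G = centroid (A, B, C)
      in second_intersection_defined c G A \<and> second_intersection_defined c G B \<and>
         second_intersection_defined c G C)"

definition triangle_seq :: "complex \<Rightarrow> triangle \<Rightarrow> nat \<Rightarrow> triangle" where
  "triangle_seq c T n = (next_triangle c ^^ n) T"

text \<open>
  The subsequence of \<open>T\<close> selected by \<open>r\<close> converges to \<open>L\<close>; the error bound refers to the
  index \<open>n = r i\<close> in the full sequence, not to the index \<open>i\<close> in the subsequence.
\<close>

definition converges_quadratically_along ::
    "(nat \<Rightarrow> nat) \<Rightarrow> (nat \<Rightarrow> triangle) \<Rightarrow> triangle \<Rightarrow> bool" where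
  "converges_quadratically_along r T L \<longleftrightarrow>
     (\<lambda>i. T (r i)) \<longlonglongrightarrow> L \<and>
     (\<exists>q::real. 0 < q \<and> q < 1 \<and>
        (\<lambda>i. dist (fst (T (r i))) (fst L)) \<in> O(\<lambda>i. q ^ (2 ^ r i)) \<and>
        (\<lambda>i. dist (fst (snd (T (r i)))) (fst (snd L))) \<in> O(\<lambda>i. q ^ (2 ^ r i)) \<and>
        (\<lambda>i. dist (snd (snd (T (r i)))) (snd (snd L))) \<in> O(\<lambda>i. q ^ (2 ^ r i)))"

fun equilateral :: "triangle \<Rightarrow> bool" where
  "equilateral (A, B, C) \<longleftrightarrow> A \<noteq> B \<and> dist A B = dist B C \<and> dist B C = dist C A"

fun symmetric_wrt :: "complex \<Rightarrow> triangle \<Rightarrow> triangle \<Rightarrow> bool" where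
  "symmetric_wrt c (A, B, C) (A', B', C') \<longleftrightarrow>
     midpoint A A' = c \<and> midpoint B B' = c \<and> midpoint C C' = c"

end

theory Submission
  imports Defs
begin

text \<open>
  Take the centre of the circle as origin and let \<open>a\<close>, \<open>b\<close>, \<open>c\<close> be the unit complex numbers
  that represent the vertices, with centroid \<open>g\<close>. The chord through \<open>a\<close> and \<open>g\<close> meets the circle
  again at \<open>(g - a) / (1 - cnj g * a)\<close>, so one step applies a single Moebius transformation of the
  disc, the involution that exchanges \<open>0\<close> and \<open>g\<close>, to all three vertices
  (\<open>is_second_intersection_iff\<close>). It is injective on the circle, so the
  vertices stay distinct.

  The speed comes from an exact law for the Fourier coordinates of the triangle. For a primitive
  cube root of unity \<open>\<omega>\<close>, put \<open>x = (a + \<omega> b + \<omega>\<^sup>2 c) / 3\<close> and \<open>y = (a + \<omega>\<^sup>2 b + \<omega> c) / 3\<close>. The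
  triangle is equilateral when one of \<open>x\<close>, \<open>y\<close> vanishes. The coordinates \<open>x'\<close>, \<open>y'\<close> of the next
  triangle satisfy \<open>x' / y' = (cnj (x / y))\<^sup>2\<close> (\<open>resolvent_ratio_step\<close>), so \<open>\<bar>x\<bar> / \<bar>y\<bar>\<close> is squared in
  each step. It differs from \<open>1\<close> because the vertices are distinct
  (\<open>norm_resolvents_distinct\<close>), and replacing \<open>\<omega>\<close> by \<open>\<omega>\<^sup>2\<close> exchanges \<open>x\<close> and \<open>y\<close>, so it may be
  assumed to be less than \<open>1\<close>; after \<open>n\<close> steps it is then at most \<open>q ^ (2 ^ n)\<close> with \<open>q < 1\<close>.
  (Geometrically, \<open>\<bar>x\<bar> / \<bar>y\<bar>\<close> is the distance from the origin to the conformal centre of the triangle.)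

  The circle condition bounds \<open>\<bar>g\<bar>\<close> by a multiple of this ratio (\<open>norm_centroid_le\<close>), and a vertex
  \<open>a\<close> and its successor \<open>a'\<close> satisfy \<open>\<bar>a' + a\<bar> \<le> 2 \<bar>g\<bar>\<close>. Hence the increments of \<open>(-1) ^ n * a n\<close> are
  \<open>O(q ^ (2 ^ n))\<close>; the sequence converges to a limit at that same speed, which gives
  antipodal limits along even and odd indices. The limits of the three vertices are unit numbers
  with sum \<open>0\<close>, because the centroids tend to \<open>0\<close>, and therefore form an equilateral triangle.
\<close>

section \<open>The step as a disc automorphism\<close>

definition disc_involution :: "complex \<Rightarrow> complex \<Rightarrow> complex" where
  "disc_involution g a = (g - a) / (1 - cnj g * a)"

lemma cnj_mult_self_unit: "cmod a = 1 \<Longrightarrow> cnj a * a = 1"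
  by (simp add: complex_norm_square[symmetric] mult.commute)

lemma one_minus_cnj_mult_nonzero:
  assumes "cmod g < 1" "cmod a = 1"
  shows "1 - cnj g * a \<noteq> 0"
proof
  assume "1 - cnj g * a = 0"
  then have "cmod (cnj g * a) = 1" by simp
  with assms show False by (simp add: norm_mult)
qed

lemma disc_involution_mult:
  assumes "cmod g < 1" "cmod a = 1"
  shows "disc_involution g a * (1 - cnj g * a) = g - a"
  using one_minus_cnj_mult_nonzero[OF assms] by (simp add: disc_involution_def)

lemma norm_disc_involution:
  assumes "cmod g < 1" "cmod a = 1"
  shows "cmod (disc_involution g a) = 1"
proof -
  have "g - a = - a * cnj (1 - cnj g * a)"
    using cnj_mult_self_unit[OF assms(2)] by (simp, algebra)
  then have "cmod (g - a) = cmod (1 - cnj g * a)"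
    using assms(2) by (metis complex_mod_cnj mult_1 norm_minus_cancel norm_mult)
  then show ?thesis
    using one_minus_cnj_mult_nonzero[OF assms] by (simp add: disc_involution_def norm_divide)
qed

lemma disc_involution_eq_iff:
  assumes "cmod g < 1" "cmod a = 1" "cmod b = 1"
  shows "disc_involution g a = disc_involution g b \<longleftrightarrow> a = b"
proof
  assume eq: "disc_involution g a = disc_involution g b"
  have "(g - a) * (1 - cnj g * b) = (g - b) * (1 - cnj g * a)"
    using eq one_minus_cnj_mult_nonzero[OF assms(1,2)] one_minus_cnj_mult_nonzero[OF assms(1,3)]
    by (simp add: disc_involution_def frac_eq_eq)
  then have "(a - b) * (1 - cnj g * g) = 0" by algebra
  moreover have "1 - cnj g * g \<noteq> 0"
  proof
    assume "1 - cnj g * g = 0"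
    then have "(cmod g)\<^sup>2 = 1"
      by (metis complex_norm_square eq_iff_diff_eq_0 mult.commute of_real_eq_1_iff)
    with assms(1) show False using norm_ge_zero[of g] by (simp add: power2_eq_1_iff)
  qed
  ultimately show "a = b" by simp
qed simp

text \<open>
  Clearing the denominator gives \<open>a' + a = g + a' * a * cnj g\<close>, in which both terms have norm
  \<open>\<bar>g\<bar>\<close>: a chord through a point near the centre has nearly antipodal ends.
\<close>
lemma norm_disc_involution_add_le:
  assumes "cmod g < 1" "cmod a = 1"
  shows "cmod (disc_involution g a + a) \<le> 2 * cmod g"
proof -
  have "disc_involution g a + a = g + disc_involution g a * a * cnj g"
    using disc_involution_mult[OF assms] by algebra
  also have "cmod \<dots> \<le> cmod g + cmod (disc_involution g a * a * cnj g)"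
    by (rule norm_triangle_ineq)
  also have "\<dots> = 2 * cmod g"
    using norm_disc_involution[OF assms] assms(2) by (simp add: norm_mult)
  finally show ?thesis .
qed

text \<open>
  A point \<open>p\<close> is on the line through \<open>a\<close> and \<open>g\<close> iff \<open>(p - a) / (g - a)\<close> equals its own conjugate.
  On the unit circle conjugation is inversion, and after division by \<open>p - a\<close> this condition becomes
  the equation \<open>p * (1 - cnj g * a) = g - a\<close>, which is linear in \<open>p\<close>.
\<close>
lemma is_second_intersection_iff:
  assumes g: "cmod (G - c) < 1" and a: "cmod (A - c) = 1"
  shows "is_second_intersection c G A P \<longleftrightarrow> P = c + disc_involution (G - c) (A - c)"
proof -
  define g a p where "g = G - c" and "a = A - c" and "p = P - c"
  have n: "cmod g < 1" "cmod a = 1" using g a by (simp_all add: g_def a_def)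
  have ca: "cnj a * a = 1" using cnj_mult_self_unit[OF n(2)] .
  have nz: "1 - cnj g * a \<noteq> 0" using one_minus_cnj_mult_nonzero[OF n] .
  have ga: "g \<noteq> a" using n by auto
  have line: "P \<in> affine hull {G, A} \<longleftrightarrow> (\<exists>t::real. p = a + of_real t * (g - a))"
  proof -
    have "P \<in> affine hull {G, A} \<longleftrightarrow> (\<exists>t::real. P = A + t *\<^sub>R (G - A))"
      by (subst insert_commute, simp add: affine_hull_2_alt image_iff)
    then show ?thesis
      by (simp add: g_def a_def p_def scaleR_conv_of_real algebra_simps)
  qed
  have "(\<exists>t::real. p = a + of_real t * (g - a)) \<and> cmod p = 1 \<and> p \<noteq> a \<longleftrightarrow>
        p = disc_involution g a" (is "?L \<longleftrightarrow> ?R")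
  proof
    assume ?L
    then obtain t :: real where t: "p = a + of_real t * (g - a)" and p: "cmod p = 1" "p \<noteq> a"
      by blast
    have cp: "cnj p * p = 1" using cnj_mult_self_unit[OF p(1)] .
    have ct: "cnj p = cnj a + of_real t * (cnj g - cnj a)" using t by simp
    have "(p - a) * (cnj g - cnj a) = (cnj p - cnj a) * (g - a)"
      using t ct by algebra
    then have "(p - a) * (p * (1 - cnj g * a) - (g - a)) = 0"
      using ca cp by algebra
    then have "p * (1 - cnj g * a) = g - a" using p(2) by simp
    then show ?R using nz by (simp add: disc_involution_def eq_divide_eq)
  next
    assume R: ?R
    have pm: "p * (1 - cnj g * a) = g - a" using disc_involution_mult[OF n] R by simp
    (* The line is not tangent at a: otherwise 2 = |a + a| <= 2 |g| < 2. *)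
    have "p \<noteq> a"
    proof
      assume "p = a"
      then have "cmod (a + a) \<le> 2 * cmod g" using norm_disc_involution_add_le[OF n] R by simp
      moreover have "cmod (a + a) = 2"
        using n(2) by (simp flip: mult_2 add: norm_mult)
      ultimately show False using n(1) by simp
    qed
    moreover have "cmod p = 1" using norm_disc_involution[OF n] R by simp
    moreover have "\<exists>t::real. p = a + of_real t * (g - a)"
    proof -
      define t where "t = (p - a) / (g - a)"
      have tm: "t * (g - a) = p - a" using ga by (simp add: t_def)
      have cp: "cnj p * p = 1" using cnj_mult_self_unit[OF \<open>cmod p = 1\<close>] .
      have ctm: "cnj t * (cnj g - cnj a) = cnj p - cnj a"
        using arg_cong[OF tm, of cnj] by simp
      have "(p - a) * (cnj g - cnj a) = (cnj p - cnj a) * (g - a)"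
        using pm ca cp by algebra
      then have "(t - cnj t) * ((g - a) * (cnj g - cnj a)) = 0"
        using tm ctm by algebra
      then have "t = cnj t" using ga by (simp flip: complex_cnj_diff)
      then have "t \<in> \<real>" by (simp add: Reals_cnj_iff)
      then obtain s :: real where "t = of_real s" by (elim Reals_cases)
      moreover have "p = a + t * (g - a)" using tm by simp
      ultimately show ?thesis by blast
    qed
    ultimately show ?L by blast
  qed
  moreover have "P \<in> sphere c 1 \<longleftrightarrow> cmod p = 1"
    by (simp add: p_def dist_norm norm_minus_commute)
  moreover have "P \<noteq> A \<longleftrightarrow> p \<noteq> a" by (simp add: p_def a_def)
  moreover have "P = c + disc_involution g a \<longleftrightarrow> p = disc_involution g a"
    by (auto simp: p_def algebra_simps)
  ultimately show ?thesis
    unfolding is_second_intersection_def line g_def[symmetric] a_def[symmetric] by blast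
qed

lemma second_intersection_eq:
  assumes "cmod (G - c) < 1" "cmod (A - c) = 1"
  shows "second_intersection_defined c G A"
    and "second_intersection c G A = c + disc_involution (G - c) (A - c)"
  using assms
  by (auto simp: second_intersection_defined_def second_intersection_def is_second_intersection_iff)

section \<open>The Fourier coordinates of a triangle\<close>

text \<open>
  The Lagrange resolvent, normalised so that the values at \<open>1\<close>, \<open>\<omega>\<close>, \<open>\<omega>\<^sup>2\<close> are the coefficients of
  the discrete Fourier transform of the triangle; the value at \<open>1\<close> is the centroid.
\<close>
definition resolvent :: "complex \<Rightarrow> complex \<Rightarrow> complex \<Rightarrow> complex \<Rightarrow> complex" where
  "resolvent \<omega> a b c = (a + \<omega> * b + \<omega>\<^sup>2 * c) / 3"

text \<open>
  The hypothesis on \<open>\<omega>\<close> singles out the two primitive cube roots of unity and is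
  stable under \<open>\<omega> \<mapsto> \<omega>\<^sup>2\<close>, so that each result about one resolvent also applies to the other.
\<close>
lemma primitive_cube_root:
  fixes \<omega> :: complex
  assumes "\<omega>\<^sup>2 + \<omega> + 1 = 0"
  shows "\<omega> ^ 3 = 1" and "cnj \<omega> = \<omega>\<^sup>2" and "(\<omega>\<^sup>2)\<^sup>2 + \<omega>\<^sup>2 + 1 = 0" and "(\<omega>\<^sup>2)\<^sup>2 = \<omega>"
    and "cmod \<omega> = 1"
proof -
  show c: "\<omega> ^ 3 = 1" using assms by algebra
  show "(\<omega>\<^sup>2)\<^sup>2 + \<omega>\<^sup>2 + 1 = 0" "(\<omega>\<^sup>2)\<^sup>2 = \<omega>" using assms by algebra+
  have "cmod \<omega> ^ 3 = 1" using c by (metis norm_one norm_power)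
  then show "cmod \<omega> = 1" using power_eq_imp_eq_base[of "cmod \<omega>" 3 1] by simp
  from cnj_mult_self_unit[OF this] show "cnj \<omega> = \<omega>\<^sup>2" using c by algebra
qed

lemma vertices_from_resolvents:
  assumes "\<omega>\<^sup>2 + \<omega> + 1 = 0"
  defines "g \<equiv> resolvent 1" and "x \<equiv> resolvent \<omega>" and "y \<equiv> resolvent (\<omega>\<^sup>2)"
  shows "a = g a b c + x a b c + y a b c"
    and "b = g a b c + \<omega>\<^sup>2 * x a b c + \<omega> * y a b c"
    and "c = g a b c + \<omega> * x a b c + \<omega>\<^sup>2 * y a b c"
proof -
  have t: "3 * g a b c = a + b + c" "3 * x a b c = a + \<omega> * b + \<omega>\<^sup>2 * c"
    "3 * y a b c = a + \<omega>\<^sup>2 * b + \<omega> * c"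
    using primitive_cube_root(4)[OF assms(1)] by (simp_all add: g_def x_def y_def resolvent_def)
  have "3 * a = 3 * (g a b c + x a b c + y a b c)"
    using t assms(1) by algebra
  then show "a = g a b c + x a b c + y a b c" by algebra
  have "3 * b = 3 * (g a b c + \<omega>\<^sup>2 * x a b c + \<omega> * y a b c)"
    using t assms(1) by algebra
  then show "b = g a b c + \<omega>\<^sup>2 * x a b c + \<omega> * y a b c" by algebra
  have "3 * c = 3 * (g a b c + \<omega> * x a b c + \<omega>\<^sup>2 * y a b c)"
    using t assms(1) by algebra
  then show "c = g a b c + \<omega> * x a b c + \<omega>\<^sup>2 * y a b c" by algebra
qed

text \<open>
  The function \<open>\<bar>a\<bar>\<^sup>2\<close> is constantly \<open>1\<close> on the vertices. The two equations are its Fourier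
  coefficients: the mean, and a nontrivial one.
\<close>
lemma resolvents_unit_circle:
  assumes \<omega>: "\<omega>\<^sup>2 + \<omega> + 1 = 0" and n: "cmod a = 1" "cmod b = 1" "cmod c = 1"
  defines "g \<equiv> resolvent 1 a b c" and "x \<equiv> resolvent \<omega> a b c" and "y \<equiv> resolvent (\<omega>\<^sup>2) a b c"
  shows "cnj g * g + cnj x * x + cnj y * y = 1"
    and "g * cnj x + x * cnj y + y * cnj g = 0"
proof -
  have t: "3 * g = a + b + c" "3 * x = a + \<omega> * b + \<omega>\<^sup>2 * c"
    "3 * y = a + \<omega>\<^sup>2 * b + \<omega> * c"
    using primitive_cube_root(4)[OF \<omega>] by (simp_all add: g_def x_def y_def resolvent_def)
  have ct: "3 * cnj g = cnj a + cnj b + cnj c"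
    "3 * cnj x = cnj a + \<omega>\<^sup>2 * cnj b + \<omega> * cnj c"
    "3 * cnj y = cnj a + \<omega> * cnj b + \<omega>\<^sup>2 * cnj c"
    using t[THEN arg_cong[of _ _ cnj]] primitive_cube_root(2,4)[OF \<omega>] by simp_all
  note u = n[THEN cnj_mult_self_unit]
  have "(3 * cnj g) * (3 * g) + (3 * cnj x) * (3 * x) + (3 * cnj y) * (3 * y) = 9"
    unfolding t ct using u \<omega> by algebra
  then have "9 * (cnj g * g + cnj x * x + cnj y * y) = 9 * 1" by (simp add: algebra_simps)
  then show "cnj g * g + cnj x * x + cnj y * y = 1" by (simp only: mult_cancel_left) simp
  have "(3 * g) * (3 * cnj x) + (3 * x) * (3 * cnj y) + (3 * y) * (3 * cnj g) = 0"
    unfolding t ct using u \<omega> by algebra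
  then have "9 * (g * cnj x + x * cnj y + y * cnj g) = 0" by (simp add: algebra_simps)
  then show "g * cnj x + x * cnj y + y * cnj g = 0" by algebra
qed

lemma norm_centroid_less_1:
  assumes n: "cmod a = 1" "cmod b = 1" "cmod c = 1" and "a \<noteq> b"
  shows "cmod (resolvent 1 a b c) < 1"
proof (rule ccontr)
  assume *: "\<not> cmod (resolvent 1 a b c) < 1"
  have "3 * cmod (resolvent 1 a b c) = cmod (a + b + c)"
    by (simp add: resolvent_def norm_divide)
  also have "\<dots> \<le> cmod (a + b) + 1" using norm_triangle_ineq[of "a + b" c] n by simp
  finally have "2 \<le> cmod (a + b)" using * by simp
  then have "cmod (a + b) = cmod a + cmod b"
    using norm_triangle_ineq[of a b] n by simp
  then have "cmod a *\<^sub>R b = cmod b *\<^sub>R a" by (metis norm_triangle_eq)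
  then have "a = b" using n by simp
  with assms show False by simp
qed

text \<open>
  Expanding in the Fourier coordinates gives \<open>-(1 - \<bar>g\<bar>\<^sup>2) * (x * (1 - \<bar>g\<bar>\<^sup>2) + cnj g * y\<^sup>2)\<close> on the right;
  the circle equations turn the last factor into \<open>cnj x * (x\<^sup>2 - g * y)\<close>. The product on the left
  is symmetric in the vertices, so it cancels when the resolvents at \<open>\<omega>\<close> and \<open>\<omega>\<^sup>2\<close> are compared.
\<close>
lemma resolvent_disc_involution:
  assumes \<omega>: "\<omega>\<^sup>2 + \<omega> + 1 = 0" and n: "cmod a = 1" "cmod b = 1" "cmod c = 1" and "a \<noteq> b"
  defines "g \<equiv> resolvent 1 a b c" and "x \<equiv> resolvent \<omega> a b c" and "y \<equiv> resolvent (\<omega>\<^sup>2) a b c"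
  shows "resolvent \<omega> (disc_involution g a) (disc_involution g b) (disc_involution g c) *
           ((1 - cnj g * a) * (1 - cnj g * b) * (1 - cnj g * c)) =
         - (1 - cnj g * g) * (cnj x * (x\<^sup>2 - g * y))"
proof -
  have g1: "cmod g < 1" using norm_centroid_less_1 assms by simp
  define a' b' c' where "a' = disc_involution g a" and "b' = disc_involution g b"
    and "c' = disc_involution g c"
  have m: "a' * (1 - cnj g * a) = g - a" "b' * (1 - cnj g * b) = g - b" "c' * (1 - cnj g * c) = g - c"
    using disc_involution_mult[OF g1] n by (simp_all add: a'_def b'_def c'_def)
  have v: "a = g + x + y" "b = g + \<omega>\<^sup>2 * x + \<omega> * y" "c = g + \<omega> * x + \<omega>\<^sup>2 * y"
    using vertices_from_resolvents[OF \<omega>, where a = a and b = b and c = c] by (simp_all add: g_def x_def y_def)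
  define h where "h = cnj g"
  have t: "3 * resolvent \<omega> a' b' c' = a' + \<omega> * b' + \<omega>\<^sup>2 * c'" by (simp add: resolvent_def)
  have "3 * resolvent \<omega> a' b' c' * ((1 - h * a) * (1 - h * b) * (1 - h * c))
      = (g - a) * (1 - h * b) * (1 - h * c) + \<omega> * ((g - b) * (1 - h * a) * (1 - h * c))
        + \<omega>\<^sup>2 * ((g - c) * (1 - h * a) * (1 - h * b))"
    using m[folded h_def] t by algebra
  also have "\<dots> = 3 * (- (1 - h * g) * (x * (1 - h * g) + h * y\<^sup>2))"
    unfolding v using \<omega> by algebra
  finally have "resolvent \<omega> a' b' c' * ((1 - h * a) * (1 - h * b) * (1 - h * c))
      = - (1 - h * g) * (x * (1 - h * g) + h * y\<^sup>2)" by algebra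
  moreover have "x * (1 - h * g) + h * y\<^sup>2 = cnj x * (x\<^sup>2 - g * y)"
    using resolvents_unit_circle[OF \<omega> n, folded g_def x_def y_def, folded h_def] by algebra
  ultimately show ?thesis by (simp add: a'_def b'_def c'_def h_def)
qed

text \<open>
  Eliminating \<open>g * cnj y\<close> by means of the nontrivial circle equation. This relates the
  cofactors of \<open>cnj x\<close> and \<open>cnj y\<close> in the two transformed resolvents.
\<close>
lemma resolvent_identity:
  assumes \<omega>: "\<omega>\<^sup>2 + \<omega> + 1 = 0" and n: "cmod a = 1" "cmod b = 1" "cmod c = 1"
  defines "g \<equiv> resolvent 1 a b c" and "x \<equiv> resolvent \<omega> a b c" and "y \<equiv> resolvent (\<omega>\<^sup>2) a b c"
  shows "(x\<^sup>2 - g * y) * cnj y = cnj x * (y\<^sup>2 - g * x)"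
proof -
  have 1: "g * cnj x + x * cnj y + y * cnj g = 0"
    using resolvents_unit_circle(2)[OF \<omega> n] by (simp add: g_def x_def y_def)
  have "cnj (g * cnj x + x * cnj y + y * cnj g) = 0" unfolding 1 by simp
  then have "cnj g * x + cnj x * y + cnj y * g = 0" by simp
  with 1 show ?thesis by algebra
qed

text \<open>
  The law \<open>x' / y' = (cnj (x / y))\<^sup>2\<close>, with denominators cleared so that it also holds if
  \<open>y\<close> or \<open>y'\<close> is \<open>0\<close>.
\<close>
lemma resolvent_ratio_step:
  assumes \<omega>: "\<omega>\<^sup>2 + \<omega> + 1 = 0" and n: "cmod a = 1" "cmod b = 1" "cmod c = 1" and ab: "a \<noteq> b"
  defines "g \<equiv> resolvent 1 a b c"
  shows "resolvent \<omega> (disc_involution g a) (disc_involution g b) (disc_involution g c) *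
           (cnj (resolvent (\<omega>\<^sup>2) a b c))\<^sup>2 =
         (cnj (resolvent \<omega> a b c))\<^sup>2 *
           resolvent (\<omega>\<^sup>2) (disc_involution g a) (disc_involution g b) (disc_involution g c)"
proof -
  define D where "D = (1 - cnj g * a) * (1 - cnj g * b) * (1 - cnj g * c)"
  have "cmod g < 1" using norm_centroid_less_1 assms by simp
  then have D: "D \<noteq> 0" using one_minus_cnj_mult_nonzero n by (simp add: D_def)
  note x' = resolvent_disc_involution[OF \<omega> n ab, folded g_def, folded D_def]
  note y' = resolvent_disc_involution[OF primitive_cube_root(3)[OF \<omega>] n ab, folded g_def, folded D_def,
      unfolded primitive_cube_root(4)[OF \<omega>]]
  have "(resolvent \<omega> (disc_involution g a) (disc_involution g b) (disc_involution g c) *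
           (cnj (resolvent (\<omega>\<^sup>2) a b c))\<^sup>2) * D =
         ((cnj (resolvent \<omega> a b c))\<^sup>2 *
           resolvent (\<omega>\<^sup>2) (disc_involution g a) (disc_involution g b) (disc_involution g c)) * D"
    using x' y' resolvent_identity[OF \<omega> n, folded g_def] by algebra
  with D show ?thesis by simp
qed

text \<open>
  If \<open>\<bar>x\<bar> = \<bar>y\<bar>\<close>, the terms with \<open>g\<close> cancel in \<open>resolvent_identity\<close> and leave \<open>x ^ 3 = y ^ 3\<close>.
  But \<open>x ^ 3 - y ^ 3\<close> is a constant multiple of \<open>(a - b) * (b - c) * (c - a)\<close>.
\<close>
lemma norm_resolvents_distinct:
  assumes \<omega>: "\<omega>\<^sup>2 + \<omega> + 1 = 0" and n: "cmod a = 1" "cmod b = 1" "cmod c = 1"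
    and d: "a \<noteq> b" "b \<noteq> c" "c \<noteq> a"
  shows "cmod (resolvent \<omega> a b c) \<noteq> cmod (resolvent (\<omega>\<^sup>2) a b c)"
proof
  define g x y where "g = resolvent 1 a b c" and "x = resolvent \<omega> a b c"
    and "y = resolvent (\<omega>\<^sup>2) a b c"
  note fold = g_def[symmetric] x_def[symmetric] y_def[symmetric]
  assume "cmod (resolvent \<omega> a b c) = cmod (resolvent (\<omega>\<^sup>2) a b c)"
  then have eq: "cmod x = cmod y" by (simp add: fold)
  then have eq2: "x * cnj x = y * cnj y" by (metis complex_norm_square)
  have v: "a = g + x + y" "b = g + \<omega>\<^sup>2 * x + \<omega> * y" "c = g + \<omega> * x + \<omega>\<^sup>2 * y"
    unfolding g_def x_def y_def by (fact vertices_from_resolvents[OF \<omega>])+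
  have "x * cnj x * (x ^ 3 - y ^ 3) = 0"
    using resolvent_identity[OF \<omega> n, unfolded fold] eq2 by algebra
  moreover have "x \<noteq> 0"
    using eq v d(1) by auto
  ultimately have "x ^ 3 = y ^ 3" by simp
  then have "(a - b) * (b - c) * (c - a) = 0"
    unfolding v using \<omega> by algebra
  with d show False by simp
qed

text \<open>
  The nontrivial circle equation expresses \<open>y * cnj g\<close> as \<open>-(g * cnj x + x * cnj y)\<close>, hence
  \<open>\<bar>g\<bar> * (\<bar>y\<bar> - \<bar>x\<bar>) \<le> \<bar>x\<bar> * \<bar>y\<bar>\<close>, and \<open>\<bar>y\<bar> \<le> 1\<close>.
\<close>
lemma norm_centroid_le:
  assumes \<omega>: "\<omega>\<^sup>2 + \<omega> + 1 = 0" and n: "cmod a = 1" "cmod b = 1" "cmod c = 1"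
    and xy: "cmod (resolvent \<omega> a b c) \<le> \<rho> * cmod (resolvent (\<omega>\<^sup>2) a b c)"
    and \<rho>: "0 \<le> \<rho>" "\<rho> < 1" and y0: "resolvent (\<omega>\<^sup>2) a b c \<noteq> 0"
  shows "cmod (resolvent 1 a b c) * (1 - \<rho>) \<le> \<rho>"
proof -
  define g x y where "g = resolvent 1 a b c" and "x = resolvent \<omega> a b c"
    and "y = resolvent (\<omega>\<^sup>2) a b c"
  note fold = g_def[symmetric] x_def[symmetric] y_def[symmetric]
  have "g * cnj x + x * cnj y + y * cnj g = 0"
    using resolvents_unit_circle(2)[OF \<omega> n] by (simp add: fold)
  then have "y * cnj g = - (g * cnj x + x * cnj y)" by algebra
  then have "cmod (y * cnj g) = cmod (g * cnj x + x * cnj y)" by (simp only: norm_minus_cancel)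
  also have "\<dots> \<le> cmod (g * cnj x) + cmod (x * cnj y)" by (rule norm_triangle_ineq)
  finally have "cmod y * cmod g \<le> cmod g * cmod x + cmod x * cmod y" by (simp add: norm_mult)
  also have "\<dots> \<le> cmod g * (\<rho> * cmod y) + \<rho> * cmod y * cmod y"
    using xy unfolding fold by (intro add_mono mult_mono) (auto simp: \<rho>(1))
  finally have "cmod y * (cmod g * (1 - \<rho>)) \<le> cmod y * (\<rho> * cmod y)"
    by (simp add: algebra_simps)
  then have 1: "cmod g * (1 - \<rho>) \<le> \<rho> * cmod y" using y0 unfolding fold by simp
  have "3 * cmod y \<le> 3"
  proof -
    have w: "cmod (\<omega>\<^sup>2) = 1"
      using primitive_cube_root(5)[OF \<omega>] by (simp add: norm_power)
    have "3 * cmod y = cmod (a + \<omega>\<^sup>2 * b + (\<omega>\<^sup>2)\<^sup>2 * c)"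
      by (simp add: y_def resolvent_def norm_divide)
    also have "\<dots> \<le> cmod a + cmod (\<omega>\<^sup>2 * b) + cmod ((\<omega>\<^sup>2)\<^sup>2 * c)"
      by (intro order_trans[OF norm_triangle_ineq] add_mono norm_triangle_ineq order_refl)
    also have "\<dots> = 3" using n w by (simp only: norm_mult norm_power) simp
    finally show ?thesis .
  qed
  then have "\<rho> * cmod y \<le> \<rho>" using \<rho>(1) by (simp add: mult_left_le)
  with 1 show ?thesis unfolding fold by simp
qed

section \<open>Quadratically small increments\<close>

text \<open>
  Since \<open>2 ^ n + k \<le> 2 ^ (n + k)\<close>, the tail of the telescoping series from \<open>n\<close> on is dominated by a
  geometric series with first term \<open>K * q ^ (2 ^ n)\<close>. Summation therefore preserves the quadratic rate.
\<close>
lemma quadratic_increments_converge: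
  fixes s :: "nat \<Rightarrow> 'a::banach"
  assumes q: "0 < q" "q < 1" and K: "0 \<le> K"
    and step: "\<And>n. norm (s (Suc n) - s n) \<le> K * q ^ (2 ^ n)"
  obtains l where "\<And>n. norm (s n - l) \<le> K / (1 - q) * q ^ (2 ^ n)"
proof -
  define d where "d k = s (Suc k) - s k" for k
  have bound: "norm (d (k + n)) \<le> K * q ^ (2 ^ n) * q ^ k" for k n
  proof -
    have "2 ^ n + k \<le> (2::nat) ^ (k + n)"
    proof (induction k)
      case (Suc k)
      have "(1::nat) \<le> 2 ^ (k + n)" by simp
      moreover have "(2::nat) ^ (Suc k + n) = 2 ^ (k + n) + 2 ^ (k + n)" by simp
      ultimately show ?case using Suc by linarith
    qed simp
    then have "q ^ (2 ^ (k + n)) \<le> q ^ (2 ^ n + k)" using q by (intro power_decreasing) auto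
    then have "K * q ^ (2 ^ (k + n)) \<le> K * q ^ (2 ^ n + k)" using K by (rule mult_left_mono)
    then show ?thesis using step[of "k + n"] by (simp add: d_def power_add mult.assoc)
  qed
  have geo: "(\<lambda>k. K * q ^ (2 ^ n) * q ^ k) sums (K / (1 - q) * q ^ (2 ^ n))" for n
    using sums_mult[OF geometric_sums[of q], of "K * q ^ (2 ^ n)"] q by (simp add: mult_ac)
  have sd: "summable (\<lambda>k. d (k + n))" for n
    by (rule summable_comparison_test'[OF sums_summable[OF geo[of n]]]) (rule bound)
  define l where "l = s 0 + suminf d"
  have "summable d" using sd[of 0] by simp
  have tele: "(\<Sum>k<n. d k) = s n - s 0" for n
    by (simp add: d_def sum_lessThan_telescope)
  have "l - s n = (\<Sum>k. d (k + n))" for n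
    using suminf_split_initial_segment[OF \<open>summable d\<close>, of n] by (simp add: tele l_def)
  moreover have "norm (\<Sum>k. d (k + n)) \<le> K / (1 - q) * q ^ (2 ^ n)" for n
    by (rule norm_suminf_le[OF bound sums_summable[OF geo], THEN order_trans])
      (simp add: sums_unique[OF geo, symmetric])
  ultimately show ?thesis using that[of l] by (metis norm_minus_commute)
qed


lemma quadratic_power_tendsto_0:
  fixes q :: real
  assumes "0 < q" "q < 1"
  shows "(\<lambda>n. q ^ (2 ^ n)) \<longlonglongrightarrow> 0"
proof (rule filterlim_compose[OF LIMSEQ_realpow_zero])
  show "filterlim (\<lambda>n. 2 ^ n :: nat) at_top sequentially"
    by (intro filterlim_subseq) (simp add: strict_mono_def)
qed (use assms in simp_all)

lemma antipodal_iteration_converges: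
  fixes s :: "nat \<Rightarrow> complex"
  assumes q: "0 < q" "q < 1" and K: "0 \<le> K"
    and unit: "\<And>n. cmod (s n) = 1"
    and step: "\<And>n. cmod (s (Suc n) + s n) \<le> K * q ^ (2 ^ n)"
  obtains l where "\<And>n. cmod ((-1) ^ n * s n - l) \<le> K / (1 - q) * q ^ (2 ^ n)" and "cmod l = 1"
    and "(\<lambda>n. (-1) ^ n * s n) \<longlonglongrightarrow> l"
proof -
  have "norm ((-1) ^ Suc n * s (Suc n) - (-1) ^ n * s n) \<le> K * q ^ (2 ^ n)" for n
  proof -
    have "(-1) ^ Suc n * s (Suc n) - (-1) ^ n * s n = - ((-1) ^ n * (s (Suc n) + s n))"
      by (simp add: algebra_simps)
    then show ?thesis using step[of n] by (simp add: norm_mult norm_power)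
  qed
  from quadratic_increments_converge[OF q K this]
  obtain l where l: "\<And>n. cmod ((-1) ^ n * s n - l) \<le> K / (1 - q) * q ^ (2 ^ n)" by blast
  have lim: "(\<lambda>n. (-1) ^ n * s n) \<longlonglongrightarrow> l"
  proof (rule LIM_zero_cancel, rule Lim_null_comparison)
    show "\<forall>\<^sub>F n in sequentially. cmod ((-1) ^ n * s n - l) \<le> K / (1 - q) * q ^ (2 ^ n)"
      using l by simp
    show "(\<lambda>n. K / (1 - q) * q ^ (2 ^ n)) \<longlonglongrightarrow> 0"
      using q by (intro tendsto_mult_right_zero quadratic_power_tendsto_0)
  qed
  have "(\<lambda>n. cmod ((-1) ^ n * s n)) \<longlonglongrightarrow> cmod l" using lim by (rule tendsto_norm)
  then have "(\<lambda>n. 1) \<longlonglongrightarrow> cmod l" by (simp add: norm_mult norm_power unit)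
  then have "cmod l = 1" by (simp add: LIMSEQ_const_iff)
  with l lim that show ?thesis by blast
qed

text \<open>
  The parallelogram law with \<open>\<bar>a + b\<bar> = \<bar>- c\<bar> = 1\<close>.
\<close>
lemma unit_zero_sum_dist:
  assumes "cmod a = 1" "cmod b = 1" "cmod c = 1" "a + b + c = 0"
  shows "cmod (a - b) = sqrt 3"
proof -
  have "a + b = - c" using assms(4) by algebra
  then have "cmod (a + b) = 1" using assms(3) by simp
  moreover have "(cmod (a - b))\<^sup>2 + (cmod (a + b))\<^sup>2 = 2 * (cmod a)\<^sup>2 + 2 * (cmod b)\<^sup>2"
    by (simp add: power2_norm_eq_inner inner_add inner_diff)
  ultimately have "(cmod (a - b))\<^sup>2 = 3" using assms by simp
  then show ?thesis by (metis norm_ge_zero real_sqrt_unique)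
qed

section \<open>Convergence of the iteration\<close>

lemma next_triangle_inscribed:
  assumes "inscribed_triangle c (A, B, C)"
  defines "g \<equiv> resolvent 1 (A - c) (B - c) (C - c)"
  shows "next_triangle_defined c (A, B, C)"
    and "next_triangle c (A, B, C) =
      (c + disc_involution g (A - c), c + disc_involution g (B - c), c + disc_involution g (C - c))"
    and "inscribed_triangle c (next_triangle c (A, B, C))"
proof -
  have u: "cmod (A - c) = 1" "cmod (B - c) = 1" "cmod (C - c) = 1"
    and d: "A \<noteq> B" "B \<noteq> C" "C \<noteq> A"
    using assms(1) by (simp_all add: dist_norm norm_minus_commute)
  have g: "cmod g < 1" unfolding g_def using u d by (intro norm_centroid_less_1) auto
  have G: "centroid (A, B, C) - c = g" by (simp add: g_def resolvent_def field_simps)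
  note si = second_intersection_eq[of "centroid (A, B, C)" c, unfolded G, OF g]
  show "next_triangle_defined c (A, B, C)"
    unfolding next_triangle_defined.simps Let_def using si(1) u by blast
  show eq: "next_triangle c (A, B, C) =
      (c + disc_involution g (A - c), c + disc_involution g (B - c), c + disc_involution g (C - c))"
    using si(2) u by (simp only: next_triangle.simps Let_def)
  show "inscribed_triangle c (next_triangle c (A, B, C))"
    unfolding eq using g u d
    by (simp add: dist_norm norm_disc_involution disc_involution_eq_iff)
qed

lemma resolvent_ratio_squares:
  assumes \<omega>: "\<omega>\<^sup>2 + \<omega> + 1 = 0" and n: "cmod a = 1" "cmod b = 1" "cmod c = 1" and ab: "a \<noteq> b"
    and xy: "cmod (resolvent \<omega> a b c) \<le> \<rho> * cmod (resolvent (\<omega>\<^sup>2) a b c)"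
    and y0: "resolvent (\<omega>\<^sup>2) a b c \<noteq> 0"
  defines "g \<equiv> resolvent 1 a b c"
  defines "a' \<equiv> disc_involution g a" and "b' \<equiv> disc_involution g b" and "c' \<equiv> disc_involution g c"
  shows "cmod (resolvent \<omega> a' b' c') \<le> \<rho>\<^sup>2 * cmod (resolvent (\<omega>\<^sup>2) a' b' c')"
proof -
  have "cmod (resolvent \<omega> a' b' c') * (cmod (resolvent (\<omega>\<^sup>2) a b c))\<^sup>2 =
        (cmod (resolvent \<omega> a b c))\<^sup>2 * cmod (resolvent (\<omega>\<^sup>2) a' b' c')"
    using arg_cong[OF resolvent_ratio_step[OF \<omega> n ab], of cmod]
    by (simp add: norm_mult norm_power a'_def b'_def c'_def g_def)
  also have "\<dots> \<le> (\<rho> * cmod (resolvent (\<omega>\<^sup>2) a b c))\<^sup>2 * cmod (resolvent (\<omega>\<^sup>2) a' b' c')"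
    using xy by (intro mult_right_mono power_mono) auto
  also have "\<dots> = \<rho>\<^sup>2 * cmod (resolvent (\<omega>\<^sup>2) a' b' c') * (cmod (resolvent (\<omega>\<^sup>2) a b c))\<^sup>2"
    by (simp add: power_mult_distrib)
  finally show ?thesis using y0 by simp
qed

text \<open>
  The choice between the two primitive cube roots of unity is the choice of an orientation of the
  triangle.
\<close>
lemma exists_dominated_resolvent:
  assumes n: "cmod a = 1" "cmod b = 1" "cmod c = 1" and d: "a \<noteq> b" "b \<noteq> c" "c \<noteq> a"
  obtains \<omega> where "\<omega>\<^sup>2 + \<omega> + 1 = 0" "cmod (resolvent \<omega> a b c) < cmod (resolvent (\<omega>\<^sup>2) a b c)"
proof -
  define w where "w = Complex (-1/2) (sqrt 3 / 2)"
  have w: "w\<^sup>2 + w + 1 = 0" by (simp add: w_def complex_eq_iff power2_eq_square)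
  show ?thesis
  proof (cases "cmod (resolvent w a b c) < cmod (resolvent (w\<^sup>2) a b c)")
    case True
    with w that show ?thesis by blast
  next
    case False
    then have "cmod (resolvent (w\<^sup>2) a b c) < cmod (resolvent ((w\<^sup>2)\<^sup>2) a b c)"
      using norm_resolvents_distinct[OF w n d] primitive_cube_root(4)[OF w] by simp
    with primitive_cube_root(3)[OF w] that show ?thesis by blast
  qed
qed

text \<open>
  Induction with \<open>resolvent_ratio_squares\<close>, starting from the initial ratio \<open>\<bar>x\<bar> / \<bar>y\<bar> < 1\<close>. The
  resolvent \<open>y\<close> never vanishes: otherwise the dominated \<open>x\<close> would vanish too, and the vertices would coincide.
\<close>
lemma centroids_quadratically_small:
  fixes a b c g :: "nat \<Rightarrow> complex"
  assumes g_def: "\<And>n. g n = resolvent 1 (a n) (b n) (c n)"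
    and unit: "\<And>n. cmod (a n) = 1" "\<And>n. cmod (b n) = 1" "\<And>n. cmod (c n) = 1"
    and dist: "\<And>n. a n \<noteq> b n" "\<And>n. b n \<noteq> c n" "\<And>n. c n \<noteq> a n"
    and step: "\<And>n. a (Suc n) = disc_involution (g n) (a n)"
      "\<And>n. b (Suc n) = disc_involution (g n) (b n)"
      "\<And>n. c (Suc n) = disc_involution (g n) (c n)"
  obtains q where "0 < q" "q < 1" "\<And>n. cmod (g n) \<le> 1 / (1 - q) * q ^ (2 ^ n)"
proof -
  obtain \<omega> where \<omega>: "\<omega>\<^sup>2 + \<omega> + 1 = 0"
    and less: "cmod (resolvent \<omega> (a 0) (b 0) (c 0)) < cmod (resolvent (\<omega>\<^sup>2) (a 0) (b 0) (c 0))"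
    using exists_dominated_resolvent[OF unit dist] by blast
  define x where "x n = resolvent \<omega> (a n) (b n) (c n)" for n
  define y where "y n = resolvent (\<omega>\<^sup>2) (a n) (b n) (c n)" for n
  (* The initial ratio is 0 for an equilateral triangle; the maximum keeps q positive. *)
  define q where "q = max (1 / 2) (cmod (x 0) / cmod (y 0))"
  have y0: "0 < cmod (y 0)" using less unfolding x_def y_def by (metis norm_ge_zero le_less_trans)
  have q: "0 < q" "q < 1" using less y0 by (auto simp: q_def x_def y_def)
  have xy: "cmod (x n) \<le> q ^ (2 ^ n) * cmod (y n)" and ynz: "y n \<noteq> 0" for n
  proof -
    have nz: "y n \<noteq> 0" if "cmod (x n) \<le> q ^ (2 ^ n) * cmod (y n)" for n
    proof
      assume "y n = 0"
      with that have "x n = 0" by simp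
      with \<open>y n = 0\<close> have "a n = b n"
        using vertices_from_resolvents(1,2)[OF \<omega>, where a = "a n" and b = "b n" and c = "c n"]
        by (simp add: x_def y_def)
      with dist(1) show False by blast
    qed
    show "cmod (x n) \<le> q ^ (2 ^ n) * cmod (y n)"
    proof (induction n)
      case 0
      have "cmod (x 0) / cmod (y 0) \<le> q" by (simp add: q_def)
      then show ?case using y0 by (simp add: divide_le_eq)
    next
      case (Suc n)
      have "cmod (x (Suc n)) \<le> (q ^ (2 ^ n))\<^sup>2 * cmod (y (Suc n))"
        unfolding x_def y_def step g_def
        using Suc nz[OF Suc] by (intro resolvent_ratio_squares \<omega> unit dist) (simp_all add: x_def y_def)
      then show ?case by (simp add: power_mult[symmetric] mult.commute)
    qed
    from nz[OF this] show "y n \<noteq> 0" .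
  qed
  have "cmod (g n) \<le> 1 / (1 - q) * q ^ (2 ^ n)" for n
  proof -
    have le: "q ^ (2 ^ n) \<le> q" using q power_decreasing[of 1 "2 ^ n" q] by simp
    have "cmod (g n) * (1 - q) \<le> cmod (g n) * (1 - q ^ (2 ^ n))"
      using le by (intro mult_left_mono) auto
    also have "\<dots> \<le> q ^ (2 ^ n)"
      unfolding g_def using xy[of n] ynz[of n] le q
      by (intro norm_centroid_le[OF \<omega>] unit) (simp_all add: x_def y_def)
    finally show ?thesis using q by (simp add: field_simps)
  qed
  with q that show ?thesis by blast
qed

lemma iteration_limits:
  fixes a b c g :: "nat \<Rightarrow> complex"
  assumes g_def: "\<And>n. g n = resolvent 1 (a n) (b n) (c n)"
    and unit: "\<And>n. cmod (a n) = 1" "\<And>n. cmod (b n) = 1" "\<And>n. cmod (c n) = 1"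
    and dist: "\<And>n. a n \<noteq> b n" "\<And>n. b n \<noteq> c n" "\<And>n. c n \<noteq> a n"
    and step: "\<And>n. a (Suc n) = disc_involution (g n) (a n)"
      "\<And>n. b (Suc n) = disc_involution (g n) (b n)"
      "\<And>n. c (Suc n) = disc_involution (g n) (c n)"
  obtains q K u v w where "0 < q" "q < 1"
    "\<And>n. cmod ((-1) ^ n * a n - u) \<le> K * q ^ (2 ^ n)"
    "\<And>n. cmod ((-1) ^ n * b n - v) \<le> K * q ^ (2 ^ n)"
    "\<And>n. cmod ((-1) ^ n * c n - w) \<le> K * q ^ (2 ^ n)"
    "cmod u = 1" "cmod v = 1" "cmod w = 1" "u + v + w = 0"
proof -
  obtain q where q: "0 < q" "q < 1" and gq: "\<And>n. cmod (g n) \<le> 1 / (1 - q) * q ^ (2 ^ n)"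
    by (rule centroids_quadratically_small[of g a b c, OF g_def unit dist step], rule that)
  define K where "K = 2 / (1 - q)"
  have K: "0 \<le> K" using q by (simp add: K_def)
  have g1: "cmod (g n) < 1" for n
    unfolding g_def by (intro norm_centroid_less_1 unit dist)
  have "cmod (disc_involution (g n) z + z) \<le> K * q ^ (2 ^ n)" if "cmod z = 1" for z n
    using norm_disc_involution_add_le[OF g1 that, of n] gq[of n] by (simp add: K_def)
  then have sum: "cmod (a (Suc n) + a n) \<le> K * q ^ (2 ^ n)" "cmod (b (Suc n) + b n) \<le> K * q ^ (2 ^ n)"
      "cmod (c (Suc n) + c n) \<le> K * q ^ (2 ^ n)" for n
    by (simp_all only: step unit)
  obtain u where u: "\<And>n. cmod ((-1) ^ n * a n - u) \<le> K / (1 - q) * q ^ (2 ^ n)" "cmod u = 1"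
      "(\<lambda>n. (-1) ^ n * a n) \<longlonglongrightarrow> u"
    by (rule antipodal_iteration_converges[of q K a, OF q K unit(1) sum(1)], rule that)
  obtain v where v: "\<And>n. cmod ((-1) ^ n * b n - v) \<le> K / (1 - q) * q ^ (2 ^ n)" "cmod v = 1"
      "(\<lambda>n. (-1) ^ n * b n) \<longlonglongrightarrow> v"
    by (rule antipodal_iteration_converges[of q K b, OF q K unit(2) sum(2)], rule that)
  obtain w where w: "\<And>n. cmod ((-1) ^ n * c n - w) \<le> K / (1 - q) * q ^ (2 ^ n)" "cmod w = 1"
      "(\<lambda>n. (-1) ^ n * c n) \<longlonglongrightarrow> w"
    by (rule antipodal_iteration_converges[of q K c, OF q K unit(3) sum(3)], rule that)
  have "(\<lambda>n. (-1) ^ n * a n + (-1) ^ n * b n + (-1) ^ n * c n) \<longlonglongrightarrow> u + v + w"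
    using u(3) v(3) w(3) by (intro tendsto_add)
  moreover have "(\<lambda>n. (-1) ^ n * a n + (-1) ^ n * b n + (-1) ^ n * c n) \<longlonglongrightarrow> 0"
  proof (rule Lim_null_comparison)
    have "cmod ((-1) ^ n * a n + (-1) ^ n * b n + (-1) ^ n * c n) \<le> 3 / (1 - q) * q ^ (2 ^ n)" for n
    proof -
      have "(-1) ^ n * a n + (-1) ^ n * b n + (-1) ^ n * c n = (-1) ^ n * (3 * g n)"
        by (simp add: g_def resolvent_def algebra_simps)
      then show ?thesis using gq[of n] by (simp add: norm_mult norm_power)
    qed
    then show "\<forall>\<^sub>F n in sequentially. cmod ((-1) ^ n * a n + (-1) ^ n * b n + (-1) ^ n * c n)
        \<le> 3 / (1 - q) * q ^ (2 ^ n)"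
      by simp
    show "(\<lambda>n. 3 / (1 - q) * q ^ (2 ^ n)) \<longlonglongrightarrow> 0"
      using q by (intro tendsto_mult_right_zero quadratic_power_tendsto_0)
  qed
  ultimately have "u + v + w = 0" by (rule LIMSEQ_unique)
  then show ?thesis by (rule that[OF q u(1) v(1) w(1) u(2) v(2) w(2)])
qed

lemma converges_quadratically_alongI:
  assumes r: "filterlim r at_top sequentially" and q: "0 < q" "q < 1"
    and bound: "\<And>i. dist (fst (T (r i))) A \<le> K * q ^ (2 ^ r i)"
      "\<And>i. dist (fst (snd (T (r i)))) B \<le> K * q ^ (2 ^ r i)"
      "\<And>i. dist (snd (snd (T (r i)))) C \<le> K * q ^ (2 ^ r i)"
  shows "converges_quadratically_along r T (A, B, C)"
proof -
  have lim0: "(\<lambda>i. K * q ^ (2 ^ r i)) \<longlonglongrightarrow> 0"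
    using filterlim_compose[OF quadratic_power_tendsto_0[OF q] r] by (rule tendsto_mult_right_zero)
  have lim: "f \<longlonglongrightarrow> l" if "\<And>i. dist (f i) l \<le> K * q ^ (2 ^ r i)" for f :: "nat \<Rightarrow> complex" and l
    by (rule LIM_zero_cancel, rule Lim_null_comparison[OF _ lim0])
      (use that in \<open>simp add: dist_norm\<close>)
  have big: "(\<lambda>i. dist (f i) l) \<in> O(\<lambda>i. q ^ (2 ^ r i))"
    if "\<And>i. dist (f i) l \<le> K * q ^ (2 ^ r i)" for f :: "nat \<Rightarrow> complex" and l
    using that q by (intro bigoI[of _ K]) simp
  have "(\<lambda>i. (fst (T (r i)), fst (snd (T (r i))), snd (snd (T (r i))))) \<longlonglongrightarrow> (A, B, C)"
    by (intro tendsto_Pair lim bound)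
  then show ?thesis
    unfolding converges_quadratically_along_def using q big[OF bound(1)] big[OF bound(2)] big[OF bound(3)]
    by auto
qed

theorem theorem5:
  fixes c A\<^sub>0 B\<^sub>0 C\<^sub>0 :: complex
  assumes "A\<^sub>0 \<in> sphere c 1" and "B\<^sub>0 \<in> sphere c 1" and "C\<^sub>0 \<in> sphere c 1"
    and "A\<^sub>0 \<noteq> B\<^sub>0" and "B\<^sub>0 \<noteq> C\<^sub>0" and "C\<^sub>0 \<noteq> A\<^sub>0"
  shows "(\<forall>n. inscribed_triangle c (triangle_seq c (A\<^sub>0, B\<^sub>0, C\<^sub>0) n) \<and>
              next_triangle_defined c (triangle_seq c (A\<^sub>0, B\<^sub>0, C\<^sub>0) n)) \<and>
         (\<exists>L M. converges_quadratically_along (\<lambda>i. 2 * i) (triangle_seq c (A\<^sub>0, B\<^sub>0, C\<^sub>0)) L \<and>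
                converges_quadratically_along (\<lambda>i. 2 * i + 1) (triangle_seq c (A\<^sub>0, B\<^sub>0, C\<^sub>0)) M \<and>
                equilateral L \<and> equilateral M \<and> symmetric_wrt c L M)"
proof -
  define T where "T = triangle_seq c (A\<^sub>0, B\<^sub>0, C\<^sub>0)"
  have T_Suc: "T (Suc n) = next_triangle c (T n)" for n
    by (simp add: T_def triangle_seq_def)
  have ins: "inscribed_triangle c (T n)" for n
  proof (induction n)
    case 0
    show ?case using assms by (simp add: T_def triangle_seq_def)
  next
    case (Suc n)
    then show ?case unfolding T_Suc by (cases "T n") (simp only: next_triangle_inscribed(3))
  qed
  have defd: "next_triangle_defined c (T n)" for n
    using ins[of n] by (cases "T n") (simp only: next_triangle_inscribed(1))

  define a where "a n = fst (T n) - c" for n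
  define b where "b n = fst (snd (T n)) - c" for n
  define d where "d n = snd (snd (T n)) - c" for n
  define g where "g n = resolvent 1 (a n) (b n) (d n)" for n
  have Tn: "T n = (c + a n, c + b n, c + d n)" for n
    by (simp add: a_def b_def d_def)
  have unit: "cmod (a n) = 1" "cmod (b n) = 1" "cmod (d n) = 1"
    and dist: "a n \<noteq> b n" "b n \<noteq> d n" "d n \<noteq> a n" for n
    using ins[of n] by (auto simp: Tn dist_norm)
  have step: "a (Suc n) = disc_involution (g n) (a n)"
    "b (Suc n) = disc_involution (g n) (b n)"
    "d (Suc n) = disc_involution (g n) (d n)" for n
    using next_triangle_inscribed(2)[OF ins[of n, unfolded Tn]] T_Suc[of n] unfolding Tn g_def by simp_all

  obtain q K u v w where q: "0 < q" "q < 1" and lim: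
    "\<And>n. cmod ((-1) ^ n * a n - u) \<le> K * q ^ (2 ^ n)"
    "\<And>n. cmod ((-1) ^ n * b n - v) \<le> K * q ^ (2 ^ n)"
    "\<And>n. cmod ((-1) ^ n * d n - w) \<le> K * q ^ (2 ^ n)"
    and uvw: "cmod u = 1" "cmod v = 1" "cmod w = 1" "u + v + w = 0"
    by (rule iteration_limits[of g a b d, OF g_def unit dist step], rule that)
  have sides: "cmod (u - v) = sqrt 3" "cmod (v - w) = sqrt 3" "cmod (w - u) = sqrt 3"
    using unit_zero_sum_dist[of u v w] unit_zero_sum_dist[of v w u] unit_zero_sum_dist[of w u v] uvw
    by (simp_all only: add.commute add.left_commute)
  then have "u \<noteq> v" by auto

  have "converges_quadratically_along (\<lambda>i. 2 * i) T (c + u, c + v, c + w)"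
  proof (rule converges_quadratically_alongI[OF _ q])
    show "filterlim (\<lambda>i::nat. 2 * i) at_top sequentially"
      by (intro filterlim_subseq) (simp add: strict_mono_def)
  qed (use lim[of "2 * i" for i] in \<open>simp_all add: Tn dist_norm\<close>)
  moreover have "converges_quadratically_along (\<lambda>i. 2 * i + 1) T (c - u, c - v, c - w)"
  proof (rule converges_quadratically_alongI[OF _ q])
    show "filterlim (\<lambda>i::nat. 2 * i + 1) at_top sequentially"
      by (intro filterlim_subseq) (simp add: strict_mono_def)
    have "cmod (z + l) = cmod (- z - l)" for z l :: complex
      using norm_minus_cancel[of "z + l"] by (simp add: minus_diff_commute)
    then show "dist (fst (T (2 * i + 1))) (c - u) \<le> K * q ^ 2 ^ (2 * i + 1)"
      "dist (fst (snd (T (2 * i + 1)))) (c - v) \<le> K * q ^ 2 ^ (2 * i + 1)"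
      "dist (snd (snd (T (2 * i + 1)))) (c - w) \<le> K * q ^ 2 ^ (2 * i + 1)" for i
      using lim[of "2 * i + 1"] by (simp_all add: Tn dist_norm)
  qed
  moreover have "equilateral (c + u, c + v, c + w)"
    using sides \<open>u \<noteq> v\<close> by (simp add: dist_norm)
  moreover have "equilateral (c - u, c - v, c - w)"
    using sides \<open>u \<noteq> v\<close> by (simp add: dist_norm norm_minus_commute)
  moreover have "symmetric_wrt c (c + u, c + v, c + w) (c - u, c - v, c - w)"
    by (simp add: midpoint_def scaleR_2[symmetric])
  ultimately show ?thesis
    unfolding T_def[symmetric] using ins defd
    by (intro conjI allI exI[of _ "(c + u, c + v, c + w)"] exI[of _ "(c - u, c - v, c - w)"])
qed

end
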